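(* Let $n\ge1$ and let $\mathrm{IP}:\{0,1\}^n\times\{0,1\}^n\to\{0,1\}$ be the bitwise inner product, $\mathrm{IP}(x,y)=\sum_{i=1}^n x_iy_i \pmod 2$. Then $GH(\mathrm{IP})\le 4n+1$.
   Context: Garden-hose game of size $s\in\mathbb{N}$: let $A=\{1^A,\dots,s^A\}$, $B=\{1^B,\dots,s^B\}$, $A_\circ=A\cup\{0\}$, and $E=\{\{i^A,i^B\}:1\le i\le s\}$ (the pipes). A game $G$ is given by functions $E_{A_\circ},E_B$ on $\{0,1\}^n$, where $E_{A_\circ}(x)$ is a set of edges (no self-loops) on $A_\circ$ and $E_B(y)$ is a set of edges (no self-loops) on $B$, such that the graphs $(A_\circ,E_{A_\circ}(x))$ and $(B,E_B(y))$ have maximum degree at most $1$. Put $G(x,y)=(A_\circ\cup B,\,E\cup E_{A_\circ}(x)\cup E_B(y))$. There is a unique maximal path $\pi(x,y)$ in $G(x,y)$ starting at $0$ (it consists of $0$ alone if $0$ has degree $0$). $G$ computes $f$ if for all $x,y$ the endpoint of $\pi(x,y)$ lies in $A_\circ$ when $f(x,y)=0$ and in $B$ when $f(x,y)=1$. $GH(f)$ is the smallest size $s$ of a game computing $f$. *)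

theory Defs
  imports "HOL-Library.FuncSet" "HOL-Library.Extended_Nat"
begin

definition cube :: "nat \<Rightarrow> (nat \<Rightarrow> nat) set" where
  "cube n = ({1..n} \<rightarrow>\<^sub>E {0, 1})"

definition IP :: "nat \<Rightarrow> (nat \<Rightarrow> nat) \<Rightarrow> (nat \<Rightarrow> nat) \<Rightarrow> nat" where
  "IP n x y = (\<Sum>i = 1..n. x i * y i) mod 2"

text \<open>Undirected graphs are pairs of a vertex set and a set of two-element edge sets.\<close>

definition loopfree_edges :: "'v set \<Rightarrow> 'v set set" where
  "loopfree_edges V = {{u, v} | u v. u \<in> V \<and> v \<in> V \<and> u \<noteq> v}"

definition degree :: "'v set set \<Rightarrow> 'v \<Rightarrow> nat" where
  "degree E v = card {e \<in> E. v \<in> e}"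

definition graph_path :: "'v set \<Rightarrow> 'v set set \<Rightarrow> 'v list \<Rightarrow> bool" where
  "graph_path V E p \<longleftrightarrow>
     p \<noteq> [] \<and> set p \<subseteq> V \<and> distinct p \<and> successively (\<lambda>u v. {u, v} \<in> E) p"

definition maximal_path_from :: "'v set \<Rightarrow> 'v set set \<Rightarrow> 'v \<Rightarrow> 'v list \<Rightarrow> bool" where
  "maximal_path_from V E z p \<longleftrightarrow>
     graph_path V E p \<and> hd p = z \<and> (\<nexists>v. graph_path V E (p @ [v]))"

datatype vertex = Zero | VA nat | VB nat

definition A_side :: "nat \<Rightarrow> vertex set" where
  "A_side s = insert Zero (VA ` {1..s})"

definition B_side :: "nat \<Rightarrow> vertex set" where
  "B_side s = VB ` {1..s}"

definition pipes :: "nat \<Rightarrow> vertex set set" where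
  "pipes s = {{VA i, VB i} | i. 1 \<le> i \<and> i \<le> s}"

record game =
  edges_A :: "(nat \<Rightarrow> nat) \<Rightarrow> vertex set set"
  edges_B :: "(nat \<Rightarrow> nat) \<Rightarrow> vertex set set"

definition is_game :: "nat \<Rightarrow> nat \<Rightarrow> game \<Rightarrow> bool" where
  "is_game n s G \<longleftrightarrow>
     (\<forall>x \<in> cube n. edges_A G x \<subseteq> loopfree_edges (A_side s) \<and>
        (\<forall>v \<in> A_side s. degree (edges_A G x) v \<le> 1)) \<and>
     (\<forall>y \<in> cube n. edges_B G y \<subseteq> loopfree_edges (B_side s) \<and>
        (\<forall>v \<in> B_side s. degree (edges_B G y) v \<le> 1))"

definition game_vertices :: "nat \<Rightarrow> vertex set" where
  "game_vertices s = A_side s \<union> B_side s"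

definition game_edges :: "nat \<Rightarrow> game \<Rightarrow> (nat \<Rightarrow> nat) \<Rightarrow> (nat \<Rightarrow> nat) \<Rightarrow> vertex set set" where
  "game_edges s G x y = pipes s \<union> edges_A G x \<union> edges_B G y"

text \<open>The description is justified by \<open>ex1_maximal_path\<close> below.\<close>

definition water_path :: "nat \<Rightarrow> game \<Rightarrow> (nat \<Rightarrow> nat) \<Rightarrow> (nat \<Rightarrow> nat) \<Rightarrow> vertex list" where
  "water_path s G x y =
     (THE p. maximal_path_from (game_vertices s) (game_edges s G x y) Zero p)"

definition computes ::
  "nat \<Rightarrow> nat \<Rightarrow> game \<Rightarrow> ((nat \<Rightarrow> nat) \<Rightarrow> (nat \<Rightarrow> nat) \<Rightarrow> nat) \<Rightarrow> bool" where
  "computes n s G f \<longleftrightarrow>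
     (\<forall>x \<in> cube n. \<forall>y \<in> cube n.
        (f x y = 0 \<longrightarrow> last (water_path s G x y) \<in> A_side s) \<and>
        (f x y = 1 \<longrightarrow> last (water_path s G x y) \<in> B_side s))"

text \<open>The infimum is taken in \<^typ>\<open>enat\<close> so that it would be infinite, rather than an
  unspecified natural number, if no game computed \<open>f\<close>.\<close>

definition GH :: "nat \<Rightarrow> ((nat \<Rightarrow> nat) \<Rightarrow> (nat \<Rightarrow> nat) \<Rightarrow> nat) \<Rightarrow> enat" where
  "GH n f = Inf (enat ` {s. \<exists>G. is_game n s G \<and> computes n s G f})"

lemma finite_loopfree_edges: "finite V \<Longrightarrow> finite (loopfree_edges V)"
  by (rule finite_subset[of _ "Pow V"]) (auto simp: loopfree_edges_def)

lemma degree_le_1_unique: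
  assumes "finite V" "E \<subseteq> loopfree_edges V" "\<forall>v \<in> V. degree E v \<le> 1"
    and "{v, a} \<in> E" "{v, b} \<in> E"
  shows "a = b"
proof -
  have v: "v \<in> V" using assms(2,4) by (auto simp: loopfree_edges_def doubleton_eq_iff)
  have "finite {e \<in> E. v \<in> e}"
    using finite_subset[OF assms(2) finite_loopfree_edges[OF assms(1)]] by simp
  then have "{v, a} = {v, b}"
    using v assms(3,4,5) card_le_Suc0_iff_eq[of "{e \<in> E. v \<in> e}"]
    by (auto simp: degree_def)
  then show ?thesis by (auto simp: doubleton_eq_iff)
qed

lemma finite_A_side: "finite (A_side s)" and finite_B_side: "finite (B_side s)"
  by (auto simp: A_side_def B_side_def)

lemma game_neighbours:
  assumes G: "is_game n s G" and x: "x \<in> cube n" and y: "y \<in> cube n"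
    and e: "{v, a} \<in> game_edges s G x y" "{v, b} \<in> game_edges s G x y"
      "{v, c} \<in> game_edges s G x y"
  shows "a = b \<or> a = c \<or> b = c" and "v = Zero \<Longrightarrow> a = b"
proof -
  have EA: "edges_A G x \<subseteq> loopfree_edges (A_side s)"
    and EB: "edges_B G y \<subseteq> loopfree_edges (B_side s)"
    and dA: "\<forall>v \<in> A_side s. degree (edges_A G x) v \<le> 1"
    and dB: "\<forall>v \<in> B_side s. degree (edges_B G y) v \<le> 1"
    using G x y by (auto simp: is_game_def)
  have uA: "p = q" if "{v, p} \<in> edges_A G x" "{v, q} \<in> edges_A G x" for p q
    using degree_le_1_unique[OF finite_A_side EA dA that] .
  have uB: "p = q" if "{v, p} \<in> edges_B G y" "{v, q} \<in> edges_B G y" for p q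
    using degree_le_1_unique[OF finite_B_side EB dB that] .
  have uP: "p = q" if "{v, p} \<in> pipes s" "{v, q} \<in> pipes s" for p q
    using that by (auto simp: pipes_def doubleton_eq_iff)
  have vA: "v \<in> A_side s" if "{v, p} \<in> edges_A G x" for p
    using that EA by (auto simp: loopfree_edges_def doubleton_eq_iff)
  have vB: "v \<in> B_side s" if "{v, p} \<in> edges_B G y" for p
    using that EB by (auto simp: loopfree_edges_def doubleton_eq_iff)
  have disj: "A_side s \<inter> B_side s = {}"
    by (auto simp: A_side_def B_side_def)
  show "a = b \<or> a = c \<or> b = c"
  proof (cases "v \<in> A_side s")
    case True
    then have "{v, p} \<notin> edges_B G y" for p using vB disj by blast
    then have "{v, p} \<in> pipes s \<or> {v, p} \<in> edges_A G x"
      if "{v, p} \<in> game_edges s G x y" for p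
      using that by (auto simp: game_edges_def)
    from this[OF e(1)] this[OF e(2)] this[OF e(3)] show ?thesis
      by (elim disjE) (auto dest: uA uP)
  next
    case False
    then have "{v, p} \<notin> edges_A G x" for p using vA by blast
    then have "{v, p} \<in> pipes s \<or> {v, p} \<in> edges_B G y"
      if "{v, p} \<in> game_edges s G x y" for p
      using that by (auto simp: game_edges_def)
    from this[OF e(1)] this[OF e(2)] this[OF e(3)] show ?thesis
      by (elim disjE) (auto dest: uB uP)
  qed
  have z: "{Zero, p} \<notin> pipes s" "Zero \<notin> B_side s" for p
    by (auto simp: pipes_def B_side_def doubleton_eq_iff)
  show "a = b" if "v = Zero"
  proof -
    have "{v, p} \<in> edges_A G x" if "{v, p} \<in> game_edges s G x y" for p
      using that vB[of p] z \<open>v = Zero\<close> by (auto simp: game_edges_def)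
    then show ?thesis using e(1,2) uA by blast
  qed
qed

lemma ex1_maximal_path:
  assumes G: "is_game n s G" and x: "x \<in> cube n" and y: "y \<in> cube n"
  shows "\<exists>!p. maximal_path_from (game_vertices s) (game_edges s G x y) Zero p"
proof -
  let ?V = "game_vertices s" and ?E = "game_edges s G x y"
  let ?P = "\<lambda>p. graph_path ?V ?E p \<and> hd p = Zero"
  have agree: "p ! i = q ! i" if p: "?P p" and q: "?P q" and "i < length p" "i < length q" for p q i
    using that(3,4)
  proof (induction i rule: less_induct)
    case (less i)
    have adj: "{p ! j, p ! Suc j} \<in> ?E" if "Suc j < length p" for j
      using p that by (auto simp: graph_path_def successively_conv_nth)
    have adj': "{q ! j, q ! Suc j} \<in> ?E" if "Suc j < length q" for j
      using q that by (auto simp: graph_path_def successively_conv_nth)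
    have z: "p ! 0 = Zero" "q ! 0 = Zero"
      using p q by (auto simp: graph_path_def hd_conv_nth)
    show ?case
    proof (cases i)
      case 0
      then show ?thesis using z by simp
    next
      case (Suc j)
      have eq: "q ! j = p ! j" using less.IH[of j] less.prems Suc by simp
      have ep: "{p ! j, p ! i} \<in> ?E" using adj[of j] less.prems Suc by simp
      have eq': "{p ! j, q ! i} \<in> ?E" using adj'[of j] less.prems Suc eq by simp
      show ?thesis
      proof (cases j)
        case 0
        then show ?thesis using game_neighbours(2)[OF G x y ep eq' eq'] z by simp
      next
        case (Suc k)
        have "q ! k = p ! k" using less.IH[of k] less.prems Suc \<open>i = Suc j\<close> by simp
        have e0: "{p ! j, p ! k} \<in> ?E"
          using adj[of k] less.prems Suc \<open>i = Suc j\<close> by (simp add: insert_commute)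
        have "p ! i \<noteq> p ! k" "q ! i \<noteq> q ! k"
          using p q less.prems Suc \<open>i = Suc j\<close> by (auto simp: graph_path_def nth_eq_iff_index_eq)
        then show ?thesis
          using game_neighbours(1)[OF G x y ep eq' e0] \<open>q ! k = p ! k\<close> by auto
      qed
    qed
  qed
  have le: "length q \<le> length p" if p: "maximal_path_from ?V ?E Zero p" and q: "?P q" for p q
  proof (rule ccontr)
    assume l: "\<not> length q \<le> length p"
    have p': "?P p" using p by (simp add: maximal_path_from_def)
    have "p = take (length p) q"
      using agree[OF p' q] l by (intro nth_equalityI) auto
    then have "p @ [q ! length p] = take (Suc (length p)) q"
      using l by (simp add: take_Suc_conv_app_nth)
    moreover have "graph_path ?V ?E (take (Suc (length p)) q)"
      using q by (auto simp: graph_path_def successively_conv_nth dest: in_set_takeD)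
    ultimately show False using p unfolding maximal_path_from_def by metis
  qed
  have fin: "finite ?V" by (simp add: game_vertices_def finite_A_side finite_B_side)
  have bound: "length p < Suc (card ?V)" if "?P p" for p
    using that card_mono[OF fin, of "set p"] by (auto simp: graph_path_def distinct_card less_Suc_eq_le)
  have "?P [Zero]" by (simp add: graph_path_def game_vertices_def A_side_def)
  then obtain p where p: "?P p" and max: "\<And>q. ?P q \<Longrightarrow> length q \<le> length p"
    using ex_has_greatest_nat[of ?P "[Zero]" length "Suc (card ?V)"] bound
    by (auto dest: less_imp_le)
  have "maximal_path_from ?V ?E Zero p"
  proof -
    have "\<not> graph_path ?V ?E (p @ [v])" for v
    proof
      assume "graph_path ?V ?E (p @ [v])"
      moreover have "hd (p @ [v]) = Zero" using p by (simp add: graph_path_def)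
      ultimately show False using max[of "p @ [v]"] by simp
    qed
    then show ?thesis using p by (simp add: maximal_path_from_def)
  qed
  moreover have "q = p" if "maximal_path_from ?V ?E Zero q" for q
  proof -
    have q: "?P q" using that by (simp add: maximal_path_from_def)
    have "length q = length p"
      using max[OF q] le[OF that p] by simp
    then show ?thesis using agree[OF q p] by (intro nth_equalityI) auto
  qed
  ultimately show ?thesis by blast
qed

end

(* The water carries the parity of the partial inner product by the choice between two pipes.
   Block i consists of the pipes 4i+1, ..., 4i+4 and processes coordinate i+1.  If that coordinate
   of x is 1, Alice leads parity 1 into pipe 4i+1 and parity 0 into pipe 4i+2, and Bob sends the
   water back through pipe 4i+3 (parity 0) or 4i+4 (parity 1), crossing the two tracks if his
   coordinate is 1.  If it is 0, Alice bypasses the block.  In the end Alice leads parity 1 into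
   pipe 4n+1, where it spills on Bob's side, and leaves parity 0 open on her own side. *)

theory Submission
  imports Defs
begin

section \<open>Matchings and the extension of paths\<close>

text \<open>Two edges meeting at \<open>v\<close> share it either as a \<open>p\<close>-end of both
  or as a \<open>q\<close>-end of both, since no \<open>p\<close>-end is a \<open>q\<close>-end;
  injectivity then makes their indices equal. An infinite set of edges would have
  \<open>card\<close> 0, hence the closing case split.\<close>

lemma degree_matching_le_1:
  assumes "E \<subseteq> (\<lambda>i. {p i, q i}) ` I"
    and "inj_on p I" "inj_on q I" "\<And>i j. i \<in> I \<Longrightarrow> j \<in> I \<Longrightarrow> p i \<noteq> q j"
  shows "degree E v \<le> 1"
proof -
  have "e = e'" if e: "e \<in> E" "e' \<in> E" and v: "v \<in> e" "v \<in> e'" for e e'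
  proof -
    obtain i j where ij: "i \<in> I" "j \<in> I" and eq: "e = {p i, q i}" "e' = {p j, q j}"
      using subsetD[OF assms(1) e(1)] subsetD[OF assms(1) e(2)] by (elim imageE) iprover
    have "p i \<noteq> q j" "p j \<noteq> q i" using assms(4) ij by iprover+
    moreover have "v = p i \<or> v = q i" "v = p j \<or> v = q j" using v by (simp_all add: eq)
    ultimately have "p i = p j \<or> q i = q j" by (elim disjE) simp_all
    then have "i = j" using inj_onD[OF assms(2) _ ij] inj_onD[OF assms(3) _ ij] by iprover
    then show ?thesis by (simp add: eq)
  qed
  then have "finite {e \<in> E. v \<in> e} \<Longrightarrow> card {e \<in> E. v \<in> e} \<le> Suc 0"
    by (subst card_le_Suc0_iff_eq) blast+
  then show ?thesis
    unfolding degree_def by (cases "finite {e \<in> E. v \<in> e}") simp_all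
qed

lemma graph_path_snocI:
  assumes "graph_path V E p" "v \<in> V" "v \<notin> set p" "{last p, v} \<in> E"
  shows "graph_path V E (p @ [v])"
  using assms by (auto simp: graph_path_def successively_append_iff)

lemma graph_path_snocD:
  assumes "graph_path V E (p @ [v])" "p \<noteq> []"
  shows "v \<notin> set p" "{last p, v} \<in> E"
  using assms by (auto simp: graph_path_def successively_append_iff)

lemma graph_path_last: "graph_path V E p \<Longrightarrow> last p \<in> V"
  unfolding graph_path_def by (blast intro: last_in_set)

section \<open>Construction of the game\<close>

text \<open>The vertex at which water of parity \<open>b\<close> stands after \<open>i\<close> coordinates. Since water starts with
  parity 0, the other track begins at \<open>VA 0\<close>, which is not a vertex of the game.\<close>

primrec track :: "(nat \<Rightarrow> nat) \<Rightarrow> nat \<Rightarrow> nat \<Rightarrow> vertex" where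
  "track x 0 b = (if b = 0 then Zero else VA 0)"
| "track x (Suc i) b = (if x (Suc i) = 1 then VA (4 * i + 3 + b) else track x i b)"

text \<open>For \<open>i < n\<close> the index stands for Alice's edge into block \<open>i\<close>,
  present only if that block is active. The index \<open>i = n\<close> stands for her final move and
  is available for every \<open>x\<close>.\<close>

definition alice_index :: "nat \<Rightarrow> (nat \<Rightarrow> nat) \<Rightarrow> (nat \<times> nat) set" where
  "alice_index n x = {(i, b). i \<le> n \<and> b \<le> 1 \<and> (i < n \<longrightarrow> x (Suc i) = 1)}"

text \<open>The intersection with \<^const>\<open>loopfree_edges\<close> discards the edge at \<open>VA 0\<close> and, for \<open>i = n\<close>,
  the one to \<open>VA (4 * n + 2)\<close>, so that parity 0 is left open in the end.\<close>

definition ip_game :: "nat \<Rightarrow> game" where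
  "ip_game n = \<lparr>
     edges_A = (\<lambda>x. loopfree_edges (A_side (4 * n + 1)) \<inter>
       (\<lambda>(i, b). {track x i b, VA (4 * i + 2 - b)}) ` alice_index n x),
     edges_B = (\<lambda>y. (\<lambda>(i, b). {VB (4 * i + 2 - b), VB (4 * i + 3 + (b + y (Suc i)) mod 2)}) `
       ({..<n} \<times> {..1}))\<rparr>"

section \<open>Pipe numbers modulo 4\<close>

text \<open>In block \<open>i\<close> the entrances are \<open>4 * i + 1\<close> and
  \<open>4 * i + 2\<close>, the exits \<open>4 * i + 3\<close> and \<open>4 * i + 4\<close>. Their
  residues modulo 4 are distinct, so a pipe number determines block, role and parity. Splitting on
  the bits makes the arithmetic linear with coefficient 4.\<close>

lemma exit_index_eq:
  fixes i j b c :: nat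
  assumes "4 * i + 3 + b = 4 * j + 3 + c" "b \<le> 1" "c \<le> 1"
  shows "i = j \<and> b = c"
proof -
  have "b = 0 \<or> b = 1" "c = 0 \<or> c = 1" using assms(2,3) by auto
  then show ?thesis using assms(1) by (elim disjE; simp; presburger)
qed

lemma entrance_index_eq:
  fixes i j b c :: nat
  assumes "4 * i + 2 - b = 4 * j + 2 - c" "b \<le> 1" "c \<le> 1"
  shows "i = j \<and> b = c"
proof -
  have "b = 0 \<or> b = 1" "c = 0 \<or> c = 1" using assms(2,3) by auto
  then show ?thesis using assms(1) by (elim disjE; simp; presburger)
qed

lemma exit_index_neq_entrance_index:
  fixes i j b c :: nat
  assumes "b \<le> 1" "c \<le> 1"
  shows "4 * i + 3 + b \<noteq> 4 * j + 2 - c"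
proof -
  have "b = 0 \<or> b = 1" "c = 0 \<or> c = 1" using assms by auto
  then show ?thesis by (elim disjE; simp; presburger)
qed

section \<open>Injectivity of the tracks\<close>

lemma track_cases:
  obtains "b = 0" "track x i b = Zero" | "b \<noteq> 0" "track x i b = VA 0"
    | k where "k < i" "track x i b = VA (4 * k + 3 + b)"
proof -
  have "track x i b = (if b = 0 then Zero else VA 0) \<or> (\<exists>k<i. track x i b = VA (4 * k + 3 + b))"
    by (induction i) (auto simp: less_Suc_eq)
  then show thesis using that by (auto split: if_splits)
qed

lemma track_not_VB: "track x i b \<noteq> VB k"
  by (cases rule: track_cases[of b x i]) auto

lemma track_after_active:
  assumes "i < j" "x (Suc i) = 1"
  shows "\<exists>k\<ge>i. track x j b = VA (4 * k + 3 + b)"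
  using assms by (induction j) (auto simp: less_Suc_eq)

text \<open>An active block \<open>i\<close> moves the water to an exit of a block \<open>k\<close>
  with \<open>k \<ge> i\<close>, whereas \<open>track x i b\<close> is a starting vertex or an exit
  of a block below \<open>i\<close>. At an inactive block the track stays put, which is why
  \<open>alice_index\<close> keeps only active ones below \<open>n\<close>.\<close>

lemma track_neq_later:
  assumes "i < j" "x (Suc i) = 1" "b \<le> 1" "c \<le> 1"
  shows "track x i b \<noteq> track x j c"
proof -
  obtain k where k: "k \<ge> i" "track x j c = VA (4 * k + 3 + c)"
    using track_after_active[of i j x c] assms by auto
  show ?thesis
  proof (cases rule: track_cases[of b x i])
    case (3 l)
    have "4 * l + 3 + b \<noteq> 4 * k + 3 + c"
      using exit_index_eq[of l b k c] 3(1) k(1) assms(3,4) by linarith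
    then show ?thesis unfolding 3(2) k(2) by simp
  qed (simp_all add: k(2))
qed

lemma track_inj:
  assumes "b \<le> 1" "c \<le> 1" "track x i b = track x i c"
  shows "b = c"
proof (cases rule: track_cases[of b x i])
  case (3 l)
  show ?thesis
  proof (cases rule: track_cases[of c x i])
    case (3 m)
    have "4 * l + 3 + b = 4 * m + 3 + c"
      using assms(3) using \<open>track x i b = VA _\<close> \<open>track x i c = VA _\<close> by simp
    then show ?thesis using exit_index_eq assms(1,2) by blast
  qed (use assms 3 in auto)
qed (cases rule: track_cases[of c x i]; use assms in auto)+

lemma inj_on_track: "inj_on (\<lambda>(i, b). track x i b) (alice_index n x)"
proof (rule inj_onI, clarify)
  fix i b j c
  assume ib: "(i, b) \<in> alice_index n x" and jc: "(j, c) \<in> alice_index n x"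
    and eq: "track x i b = track x j c"
  have "i = j"
    using track_neq_later[of i j x b c] track_neq_later[of j i x c b] ib jc eq
    by (cases i j rule: linorder_cases) (auto simp: alice_index_def)
  then show "i = j \<and> b = c"
    using track_inj[of b c x i] ib jc eq by (auto simp: alice_index_def)
qed

lemma track_neq_entrance:
  assumes "b \<le> 1" "c \<le> 1"
  shows "track x i b \<noteq> VA (4 * j + 2 - c)"
proof (cases rule: track_cases[of b x i])
  case (3 l)
  then show ?thesis using exit_index_neq_entrance_index[of b c l j] assms by simp
qed (use assms in auto)

section \<open>Degree bounds and validity of the game\<close>

lemma degree_edges_A_le_1: "degree (edges_A (ip_game n) x) v \<le> 1"
proof (rule degree_matching_le_1)
  show "edges_A (ip_game n) x \<subseteq>
    (\<lambda>ib. {(\<lambda>(i, b). track x i b) ib, (\<lambda>(i, b). VA (4 * i + 2 - b)) ib}) ` alice_index n x"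
    by (simp add: ip_game_def case_prod_unfold)
  show "inj_on (\<lambda>(i, b). track x i b) (alice_index n x)" by (rule inj_on_track)
  show "inj_on (\<lambda>(i, b). VA (4 * i + 2 - b)) (alice_index n x)"
  proof (rule inj_onI, clarify)
    fix i b j c
    assume "(i, b) \<in> alice_index n x" "(j, c) \<in> alice_index n x" "4 * i + 2 - b = 4 * j + 2 - c"
    then show "i = j \<and> b = c"
      unfolding alice_index_def by (intro entrance_index_eq) auto
  qed
  show "(\<lambda>(i, b). track x i b) ib \<noteq> (\<lambda>(i, b). VA (4 * i + 2 - b)) jc"
    if "ib \<in> alice_index n x" "jc \<in> alice_index n x" for ib jc
    using that track_neq_entrance[of "snd ib" "snd jc" x "fst ib" "fst jc"]
    by (simp add: alice_index_def case_prod_unfold)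
qed

lemma degree_edges_B_le_1: "degree (edges_B (ip_game n) y) v \<le> 1"
proof (rule degree_matching_le_1)
  have bit: "c mod 2 \<le> 1" for c :: nat by simp
  let ?q = "\<lambda>(i, b). VB (4 * i + 3 + (b + y (Suc i)) mod 2)"
  show "edges_B (ip_game n) y \<subseteq>
    (\<lambda>ib. {(\<lambda>(i, b). VB (4 * i + 2 - b)) ib, ?q ib}) ` ({..<n} \<times> {..1})"
    by (simp add: ip_game_def case_prod_unfold)
  show "inj_on (\<lambda>(i, b). VB (4 * i + 2 - b)) ({..<n} \<times> {..1})"
  proof (rule inj_onI, clarify)
    fix i b j c :: nat
    assume "b \<le> 1" "c \<le> 1" "4 * i + 2 - b = 4 * j + 2 - c"
    then show "i = j \<and> b = c" by (intro entrance_index_eq)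
  qed
  show "inj_on ?q ({..<n} \<times> {..1})"
  proof (rule inj_onI, clarify)
    fix i b j c
    assume bc: "b \<le> (1::nat)" "c \<le> (1::nat)"
      and "4 * i + 3 + (b + y (Suc i)) mod 2 = 4 * j + 3 + (c + y (Suc j)) mod 2"
    then have eq: "i = j" "(b + y (Suc i)) mod 2 = (c + y (Suc j)) mod 2"
      using exit_index_eq[OF _ bit bit] by iprover+
    have "b = 0 \<or> b = 1" "c = 0 \<or> c = 1" using bc by auto
    \<comment> \<open>Adding the same number \<open>y (Suc i)\<close> modulo 2 permutes the two
      parities, because consecutive numbers differ in parity; so Bob's crossing merges no
      tracks.\<close>
    moreover have "d mod 2 \<noteq> Suc d mod 2" for d :: nat by presburger
    ultimately have "b = c" using eq by (auto dest: sym)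
    then show "i = j \<and> b = c" using eq(1) by simp
  qed
  show "(\<lambda>(i, b). VB (4 * i + 2 - b)) ib \<noteq> ?q jc"
    if "ib \<in> {..<n} \<times> {..1}" for ib jc
    using that exit_index_neq_entrance_index[OF bit, of "snd ib" _ _ "fst ib"]
    by (simp only: case_prod_unfold mem_Times_iff atMost_iff vertex.inject) metis
qed

lemma is_game_ip_game: "is_game n (4 * n + 1) (ip_game n)"
proof -
  have "edges_B (ip_game n) y \<subseteq> loopfree_edges (B_side (4 * n + 1))" for y
  proof -
    have "{VB (4 * i + 2 - b), VB (4 * i + 3 + c mod 2)} \<in> loopfree_edges (B_side (4 * n + 1))"
      if "i < n" "b \<le> 1" for i b c
    proof -
      have c: "c mod 2 \<le> 1" by simp
      have "4 * i + 2 - b \<in> {1..4 * n + 1}" "4 * i + 3 + c mod 2 \<in> {1..4 * n + 1}"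
        using that c unfolding atLeastAtMost_iff by linarith+
      then have "VB (4 * i + 2 - b) \<in> B_side (4 * n + 1)"
        "VB (4 * i + 3 + c mod 2) \<in> B_side (4 * n + 1)"
        unfolding B_side_def by (blast intro: imageI)+
      moreover have "VB (4 * i + 2 - b) \<noteq> VB (4 * i + 3 + c mod 2)"
        using exit_index_neq_entrance_index[OF c that(2), of i i] by simp
      ultimately show ?thesis unfolding loopfree_edges_def by blast
    qed
    then show ?thesis by (auto simp: ip_game_def)
  qed
  moreover have "edges_A (ip_game n) x \<subseteq> loopfree_edges (A_side (4 * n + 1))" for x
    by (simp add: ip_game_def)
  ultimately show ?thesis
    unfolding is_game_def using degree_edges_A_le_1 degree_edges_B_le_1 by blast
qed

section \<open>The course of the water through the blocks\<close>

lemma IP_Suc: "IP (Suc i) x y = (IP i x y + x (Suc i) * y (Suc i)) mod 2"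
  by (simp add: IP_def mod_add_left_eq)

lemma IP_le_1: "IP n x y \<le> 1"
  by (simp add: IP_def)

text \<open>The pipe number at a vertex; bounding it along a path shows that later blocks are still
  unvisited.\<close>

primrec level :: "vertex \<Rightarrow> nat" where
  "level Zero = 0"
| "level (VA i) = i"
| "level (VB i) = i"

text \<open>The last two hypotheses put both ends into \<open>A_side\<close>, and
  \<open>track_neq_entrance\<close> excludes a loop, so the edge survives the intersection with
  \<open>loopfree_edges\<close>.\<close>

lemma alice_edge:
  assumes "(i, b) \<in> alice_index n x" "track x i b \<in> game_vertices (4 * n + 1)"
    "4 * i + 2 - b \<le> 4 * n + 1"
  shows "{track x i b, VA (4 * i + 2 - b)} \<in> game_edges (4 * n + 1) (ip_game n) x y"
proof -
  have b: "b \<le> 1" using assms(1) by (simp add: alice_index_def)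
  have "track x i b \<in> A_side (4 * n + 1)"
    using assms(2) by (auto simp: game_vertices_def B_side_def track_not_VB)
  moreover have "VA (4 * i + 2 - b) \<in> A_side (4 * n + 1)"
    using assms(3) b by (auto simp: A_side_def)
  ultimately have "{track x i b, VA (4 * i + 2 - b)} \<in> loopfree_edges (A_side (4 * n + 1))"
    using track_neq_entrance[OF b b] unfolding loopfree_edges_def by blast
  then show ?thesis using assms(1) by (force simp: game_edges_def ip_game_def)
qed

lemma bob_edge:
  assumes "i < n" "b \<le> 1"
  shows "{VB (4 * i + 2 - b), VB (4 * i + 3 + (b + y (Suc i)) mod 2)}
    \<in> game_edges (4 * n + 1) (ip_game n) x y"
  using assms by (force simp: game_edges_def ip_game_def)

lemma pipe_edge:
  assumes "1 \<le> k" "k \<le> s"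
  shows "{VA k, VB k} \<in> game_edges s G x y" "{VB k, VA k} \<in> game_edges s G x y"
  using assms by (auto simp: game_edges_def pipes_def insert_commute)

text \<open>The bound on \<open>level\<close> makes all vertices of the next block new, which keeps
  the extended path simple. The last conjunct records that the pipe at the endpoint has been used
  already; it blocks the way back when parity 0 is left open at the end.\<close>

lemma path_to_track:
  assumes "x \<in> cube n" "i \<le> n"
  shows "\<exists>p. graph_path (game_vertices (4 * n + 1)) (game_edges (4 * n + 1) (ip_game n) x y) p \<and>
    hd p = Zero \<and> last p = track x i (IP i x y) \<and> (\<forall>v \<in> set p. level v \<le> 4 * i) \<and>
    (\<forall>k. last p = VA k \<longrightarrow> VB k \<in> set p)"
  using assms(2)
proof (induction i)
  case 0
  show ?case
    by (rule exI[of _ "[Zero]"]) (simp add: graph_path_def game_vertices_def A_side_def IP_def)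
next
  case (Suc i)
  let ?V = "game_vertices (4 * n + 1)" and ?E = "game_edges (4 * n + 1) (ip_game n) x y"
  obtain p where p: "graph_path ?V ?E p" "hd p = Zero" "last p = track x i (IP i x y)"
    "\<forall>v \<in> set p. level v \<le> 4 * i" "\<forall>k. last p = VA k \<longrightarrow> VB k \<in> set p"
    using Suc by auto
  have ne: "p \<noteq> []" using p(1) by (simp add: graph_path_def)
  have "x (Suc i) \<in> {0, 1}" using assms(1) Suc.prems by (auto simp: cube_def PiE_def Pi_def)
  then consider "x (Suc i) = 0" | "x (Suc i) = 1" by auto
  then show ?case
  proof cases
    case 1
    then have "IP (Suc i) x y = IP i x y" by (simp add: IP_Suc IP_def)
    then show ?thesis using p 1 by (intro exI[of _ p]) auto
  next
    case 2
    let ?b = "IP i x y" and ?c = "IP (Suc i) x y"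
    let ?k = "4 * i + 2 - ?b" and ?l = "4 * i + 3 + ?c"
    have b: "?b \<le> 1" and c: "?c \<le> 1" by (rule IP_le_1)+
    have k: "4 * i < ?k" "?k \<le> 4 * i + 2" and l: "4 * i + 2 < ?l" "?l \<le> 4 * i + 4"
      using b c by auto
    have in_V: "VA m \<in> ?V" "VB m \<in> ?V" if "4 * i < m" "m \<le> 4 * i + 4" for m
      using that Suc.prems by (auto simp: game_vertices_def A_side_def B_side_def)
    have new: "v \<notin> set p" if "4 * i < level v" for v using p(4) that by force
    \<comment> \<open>As the end of a path, this is a vertex of the game and hence not the
      fictitious \<open>VA 0\<close>.\<close>
    have "track x i ?b \<in> ?V" using graph_path_last[OF p(1)] p(3) by simp
    then have e1: "{last p, VA ?k} \<in> ?E"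
      using alice_edge[of i ?b n x y] 2 b Suc.prems by (simp add: p(3) alice_index_def)
    have e2: "{VA ?k, VB ?k} \<in> ?E" "{VB ?l, VA ?l} \<in> ?E"
      using pipe_edge k l Suc.prems by auto
    \<comment> \<open>Since \<open>x (Suc i) = 1\<close>, Bob's shift by \<open>y (Suc i)\<close> is
      exactly the recursion \<open>IP_Suc\<close>, so the water leaves through exit
      \<open>?l\<close>.\<close>
    have e3: "{VB ?k, VB ?l} \<in> ?E"
      using bob_edge[of i n ?b y x] 2 b Suc.prems by (simp add: IP_Suc)
    have "graph_path ?V ?E (p @ [VA ?k])"
      by (rule graph_path_snocI[OF p(1) in_V(1) new e1]) (use k in simp_all)
    then have "graph_path ?V ?E ((p @ [VA ?k]) @ [VB ?k])"
      by (rule graph_path_snocI[OF _ in_V(2)]) (use k new[of "VB ?k"] e2(1) in simp_all)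
    then have "graph_path ?V ?E (((p @ [VA ?k]) @ [VB ?k]) @ [VB ?l])"
      by (rule graph_path_snocI[OF _ in_V(2)]) (use k l new[of "VB ?l"] e3 in simp_all)
    then have "graph_path ?V ?E ((((p @ [VA ?k]) @ [VB ?k]) @ [VB ?l]) @ [VA ?l])"
      by (rule graph_path_snocI[OF _ in_V(1)]) (use k l new[of "VA ?l"] e2(2) in simp_all)
    moreover have "level v \<le> 4 * Suc i" if "v \<in> set (p @ [VA ?k, VB ?k, VB ?l, VA ?l])" for v
      using that p(4) k(2) l(2) by auto
    moreover have "track x (Suc i) ?c = VA ?l" using 2 by simp
    moreover have "hd (p @ [VA ?k, VB ?k, VB ?l, VA ?l]) = Zero" using p(2) ne by simp
    ultimately show ?thesis
      by (intro exI[of _ "p @ [VA ?k, VB ?k, VB ?l, VA ?l]"]) simp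
  qed
qed

section \<open>The two dead ends\<close>

lemma loopfree_edges_subset: "e \<in> loopfree_edges V \<Longrightarrow> e \<subseteq> V"
  by (auto simp: loopfree_edges_def)

lemma edges_A_cases:
  assumes "e \<in> edges_A (ip_game n) x"
  obtains i b where "(i, b) \<in> alice_index n x" "e = {track x i b, VA (4 * i + 2 - b)}"
    "VA (4 * i + 2 - b) \<in> A_side (4 * n + 1)"
proof -
  have e: "e \<in> loopfree_edges (A_side (4 * n + 1))"
    and "e \<in> (\<lambda>(i, b). {track x i b, VA (4 * i + 2 - b)}) ` alice_index n x"
    using assms by (simp_all add: ip_game_def)
  from this(2) obtain ib where ib: "ib \<in> alice_index n x"
    "e = (\<lambda>(i, b). {track x i b, VA (4 * i + 2 - b)}) ib" by (rule imageE)
  then show thesis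
    using that[of "fst ib" "snd ib"] loopfree_edges_subset[OF e] by (simp add: case_prod_unfold)
qed

lemma edges_B_cases:
  assumes "e \<in> edges_B (ip_game n) y"
  obtains i b where "i < n" "b \<le> 1"
    "e = {VB (4 * i + 2 - b), VB (4 * i + 3 + (b + y (Suc i)) mod 2)}"
proof -
  have "e \<in> (\<lambda>(i, b). {VB (4 * i + 2 - b), VB (4 * i + 3 + (b + y (Suc i)) mod 2)}) `
      ({..<n} \<times> {..1})"
    using assms by (simp add: ip_game_def)
  then obtain ib where "ib \<in> {..<n} \<times> {..1}"
    "e = (\<lambda>(i, b). {VB (4 * i + 2 - b), VB (4 * i + 3 + (b + y (Suc i)) mod 2)}) ib"
    by (rule imageE)
  then show thesis
    using that[of "fst ib" "snd ib"] by (simp add: case_prod_unfold mem_Times_iff)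
qed

text \<open>By injectivity of the tracks, an edge of Alice here would have index
  \<open>(n, 0)\<close> and lead to \<open>VA (4 * n + 2)\<close>, beyond the last pipe. Bob has no
  edges on this side, so only the pipe is left.\<close>

lemma open_track:
  assumes "{track x n 0, v} \<in> game_edges (4 * n + 1) (ip_game n) x y"
  obtains k where "track x n 0 = VA k" "v = VB k"
proof -
  have "{track x n 0, v} \<notin> edges_A (ip_game n) x"
  proof
    assume "{track x n 0, v} \<in> edges_A (ip_game n) x"
    then obtain i b where ib: "(i, b) \<in> alice_index n x"
      and eq: "{track x n 0, v} = {track x i b, VA (4 * i + 2 - b)}"
      and side: "VA (4 * i + 2 - b) \<in> A_side (4 * n + 1)"
      by (rule edges_A_cases)
    have b: "b \<le> 1" using ib by (simp add: alice_index_def)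
    have "track x n 0 \<in> {track x i b, VA (4 * i + 2 - b)}" by (simp only: eq[symmetric] insertI1)
    then have "track x n 0 = track x i b"
      using track_neq_entrance[OF zero_le b, of x n i] by simp
    moreover have "(n, 0) \<in> alice_index n x" by (simp add: alice_index_def)
    ultimately have "(n, 0) = (i, b)"
      using inj_onD[OF inj_on_track _ _ ib, of "(n, 0)"] by simp
    then show False using side by (auto simp: A_side_def)
  qed
  moreover have "{track x n 0, v} \<notin> edges_B (ip_game n) y"
  proof
    assume "{track x n 0, v} \<in> edges_B (ip_game n) y"
    then obtain k l where "{track x n 0, v} = {VB k, VB l}" by (elim edges_B_cases) simp
    then have "track x n 0 \<in> {VB k, VB l}" by (metis insertI1)
    then show False by (simp add: track_not_VB)
  qed
  ultimately have "{track x n 0, v} \<in> pipes (4 * n + 1)"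
    using assms by (simp add: game_edges_def)
  then obtain k where "{track x n 0, v} = {VA k, VB k}" unfolding pipes_def by blast
  then show thesis
    using that[of k] track_not_VB[of x n 0 k] by (simp add: doubleton_eq_iff)
qed

text \<open>Bob's edges stay within the blocks below \<open>n\<close>, whose pipe numbers are at
  most \<open>4 * n\<close>.\<close>

lemma open_exit:
  assumes "{VB (4 * n + 1), v} \<in> game_edges (4 * n + 1) (ip_game n) x y"
  shows "v = VA (4 * n + 1)"
proof -
  have "{VB (4 * n + 1), v} \<notin> edges_A (ip_game n) x"
  proof
    assume "{VB (4 * n + 1), v} \<in> edges_A (ip_game n) x"
    then have "{VB (4 * n + 1), v} \<subseteq> A_side (4 * n + 1)"
      by (intro loopfree_edges_subset) (simp add: ip_game_def)
    then show False by (auto simp: A_side_def)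
  qed
  moreover have "{VB (4 * n + 1), v} \<notin> edges_B (ip_game n) y"
  proof
    assume "{VB (4 * n + 1), v} \<in> edges_B (ip_game n) y"
    then obtain i b where ib: "i < n" "b \<le> 1"
      and "{VB (4 * n + 1), v} = {VB (4 * i + 2 - b), VB (4 * i + 3 + (b + y (Suc i)) mod 2)}"
      by (rule edges_B_cases)
    then have "4 * n + 1 = 4 * i + 2 - b \<or> 4 * n + 1 = 4 * i + 3 + (b + y (Suc i)) mod 2"
      by (metis insertI1 insertE singletonD vertex.inject(2))
    moreover have "(b + y (Suc i)) mod 2 \<le> 1" by simp
    ultimately show False using ib by linarith
  qed
  ultimately have "{VB (4 * n + 1), v} \<in> pipes (4 * n + 1)"
    using assms by (simp add: game_edges_def)
  then show ?thesis by (auto simp: pipes_def doubleton_eq_iff)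
qed

section \<open>Where the water spills\<close>

lemma water_path_eqI:
  assumes "is_game n s G" "x \<in> cube n" "y \<in> cube n"
    and "maximal_path_from (game_vertices s) (game_edges s G x y) Zero p"
  shows "water_path s G x y = p"
  unfolding water_path_def by (rule the1_equality[OF ex1_maximal_path[OF assms(1-3)] assms(4)])

lemma computes_ip_game: "computes n (4 * n + 1) (ip_game n) (IP n)"
  unfolding computes_def
proof (intro ballI conjI impI)
  fix x y assume xy: "x \<in> cube n" "y \<in> cube n"
  let ?V = "game_vertices (4 * n + 1)" and ?E = "game_edges (4 * n + 1) (ip_game n) x y"
  obtain p where p: "graph_path ?V ?E p" "hd p = Zero" "last p = track x n (IP n x y)"
    "\<forall>v \<in> set p. level v \<le> 4 * n" "\<forall>k. last p = VA k \<longrightarrow> VB k \<in> set p"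
    using path_to_track[OF xy(1) order_refl] by blast
  have ne: "p \<noteq> []" using p(1) by (simp add: graph_path_def)
  note last_V = graph_path_last[OF p(1)]
  note water = water_path_eqI[OF is_game_ip_game xy]
  show "last (water_path (4 * n + 1) (ip_game n) x y) \<in> A_side (4 * n + 1)" if "IP n x y = 0"
  proof -
    have "\<not> graph_path ?V ?E (p @ [v])" for v
    proof
      assume "graph_path ?V ?E (p @ [v])"
      from graph_path_snocD[OF this ne] have v: "v \<notin> set p" "{track x n 0, v} \<in> ?E"
        using p(3) that by simp_all
      \<comment> \<open>The only continuation would run back through the pipe by which the water
        arrived, whose other end \<open>VB k\<close> is already on \<open>p\<close>.\<close>
      obtain k where "track x n 0 = VA k" "v = VB k" by (rule open_track[OF v(2)])
      then show False using p(3,5) v(1) that by simp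
    qed
    then have "water_path (4 * n + 1) (ip_game n) x y = p"
      using p(1,2) by (intro water) (simp add: maximal_path_from_def)
    then show ?thesis
      using last_V p(3) by (auto simp: game_vertices_def B_side_def track_not_VB)
  qed
  show "last (water_path (4 * n + 1) (ip_game n) x y) \<in> B_side (4 * n + 1)" if "IP n x y = 1"
  proof -
    let ?a = "VA (4 * n + 1)" and ?b = "VB (4 * n + 1)"
    let ?q = "(p @ [?a]) @ [?b]"
    \<comment> \<open>For index \<open>(n, 1)\<close> the entrance is \<open>4 * n + 2 - 1\<close>,
      the last pipe.\<close>
    have e: "{last p, ?a} \<in> ?E"
      using alice_edge[of n 1 n x y] last_V p(3) that by (simp add: alice_index_def)
    have ab_V: "?a \<in> ?V" "?b \<in> ?V" by (auto simp: game_vertices_def A_side_def B_side_def)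
    have ab_new: "?a \<notin> set p" "?b \<notin> set p" using p(4) by force+
    have "graph_path ?V ?E (p @ [?a])"
      by (rule graph_path_snocI[OF p(1) ab_V(1) ab_new(1) e])
    then have q: "graph_path ?V ?E ?q"
      by (rule graph_path_snocI[OF _ ab_V(2)]) (use ab_new pipe_edge in simp_all)
    have "\<not> graph_path ?V ?E (?q @ [v])" for v
    proof
      assume "graph_path ?V ?E (?q @ [v])"
      \<comment> \<open>The sole neighbour of \<open>?b\<close> is \<open>?a\<close>, which the path
        has just left.\<close>
      from graph_path_snocD[OF this] show False using open_exit[of n v x y] by simp
    qed
    then have "water_path (4 * n + 1) (ip_game n) x y = ?q"
      using p(2) ne q by (intro water) (simp add: maximal_path_from_def)
    then show ?thesis by (simp add: B_side_def)
  qed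
qed

theorem mainTheorem7:
  fixes n :: nat
  assumes "n \<ge> 1"
  shows "GH n (IP n) \<le> enat (4 * n + 1)"
  unfolding GH_def using is_game_ip_game computes_ip_game by (blast intro: Inf_lower)

end
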